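(* Let $m$ and $k$ be positive integers, and let $F$ be the forest of $m$ infinite rooted trees generated by the birth sequence vectors $\vec d_0,\vec d_1,\vec d_2,\dots$ (each with $m$ components), where each tree has its root initially on fire. Then $F$ is $k$-containable if and only if there exist some $t\in\mathbb{Z}_{\ge 0}$ and $m$-component vectors $\vec p_1,\vec p_2,\dots,\vec p_{t+1}$ with non-negative integer entries and $\|\vec p_i\|_1=k$ for all $i\in\{1,\dots,t+1\}$ such that \[ \bigodot_{i=0}^t\vec d_i-\left(\sum_{i=1}^{t}\vec p_i\odot\bigodot_{j=i}^t\vec d_j\right)-\vec p_{t+1}\le\vec 0 . \]
   Context: Vector conventions: $\odot$ and $\bigodot$ denote component-wise multiplication of vectors, $\|\cdot\|_1$ is the sum of absolute values of the components, and $\vec x\le\vec y$ means the inequality holds in every component. The depth of a vertex in a rooted tree is its distance from its root. The forest generated by birth sequence vectors $\vec d_0,\vec d_1,\dots$ consists of $m$ disjoint rooted trees, labeled $1,\dots,m$, such that every vertex of Tree $j$ at depth $i$ has exactly as many children as the $j$-th component of $\vec d_i$. The trees being infinite means that all components of all $\vec d_i$ are positive integers. Firefighter process on a graph with vertex set $V$: $F^{(t)}$ is the set of vertices on fire at turn $t$ and $P^{(t)}$ the set of protected vertices at turn $t$. On turn $1$, $F^{(1)}$ is the given initial fire (here the set of the $m$ roots) and $P^{(1)}=\varnothing$. On an even turn $2t$, the firefighters choose a subset of $V\setminus F^{(2t-1)}$ to protect; $P^{(2t)}$ is the union of $P^{(2t-1)}$ and this subset, and $F^{(2t)}=F^{(2t-1)}$.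 On an odd turn $2t+1$ with $t\ge 1$, $F^{(2t+1)}=N[F^{(2t)}]\setminus P^{(2t)}$, where $N[\cdot]$ is the closed neighborhood, and $P^{(2t+1)}=P^{(2t)}$. On turn $t$, a vertex is saved if it is in $P^{(t)}$ or lies in a component of the subgraph induced by $V\setminus P^{(t)}$ that contains no burning vertex. The fire is contained if at some turn all but finitely many vertices are saved. An infinite graph with a given initial fire is $k$-containable if the fire can be contained by protecting at most $k$ vertices (in total) on every even turn. *)

theory Defs
  imports Complex_Main "HOL-Library.Disjoint_Sets"
begin

text \<open>A simple undirected graph, possibly infinite, is given by its vertex set and its adjacency
  relation.\<close>

definition simple_graph :: "'v set \<Rightarrow> 'v rel \<Rightarrow> bool" where
  "simple_graph V E \<longleftrightarrow> E \<subseteq> V \<times> V \<and> sym E \<and> irrefl E"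

definition is_path :: "'v rel \<Rightarrow> 'v \<Rightarrow> 'v list \<Rightarrow> 'v \<Rightarrow> bool" where
  "is_path E u p v \<longleftrightarrow> p \<noteq> [] \<and> hd p = u \<and> last p = v \<and> distinct p
     \<and> successively (\<lambda>x y. (x, y) \<in> E) p"

definition tree :: "'v set \<Rightarrow> 'v rel \<Rightarrow> bool" where
  "tree V E \<longleftrightarrow> simple_graph V E \<and> V \<noteq> {} \<and> (\<forall>u\<in>V. \<forall>v\<in>V. \<exists>!p. is_path E u p v)"

text \<open>The distance from the root \<open>r\<close>: the least length of a walk. Only meaningful for vertices
  reachable from \<open>r\<close>.\<close>

definition depth :: "'v rel \<Rightarrow> 'v \<Rightarrow> 'v \<Rightarrow> nat" where
  "depth E r v = (LEAST n. (r, v) \<in> E ^^ n)"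

definition children :: "'v rel \<Rightarrow> 'v \<Rightarrow> 'v \<Rightarrow> 'v set" where
  "children E r v = {w. (v, w) \<in> E \<and> depth E r w = Suc (depth E r v)}"

text \<open>Tree \<open>j\<close> has vertex set \<open>T j\<close> and root \<open>r j\<close>, for \<open>j \<in> {1..m}\<close>; \<open>d i j\<close> is the \<open>j\<close>-th
  component of the \<open>i\<close>-th birth sequence vector. This determines the graph \<open>(V, E)\<close> up to
  isomorphism. Values of \<open>T\<close>, \<open>r\<close> and \<open>d i\<close> outside \<open>{1..m}\<close> are irrelevant.\<close>

definition generated_forest ::
    "nat \<Rightarrow> (nat \<Rightarrow> nat \<Rightarrow> nat) \<Rightarrow> 'v set \<Rightarrow> 'v rel \<Rightarrow> (nat \<Rightarrow> 'v set) \<Rightarrow> (nat \<Rightarrow> 'v) \<Rightarrow> bool" where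
  "generated_forest m d V E T r \<longleftrightarrow>
     V = (\<Union>j\<in>{1..m}. T j) \<and>
     disjoint_family_on T {1..m} \<and>
     E \<subseteq> (\<Union>j\<in>{1..m}. T j \<times> T j) \<and>
     (\<forall>j\<in>{1..m}. tree (T j) (E \<inter> T j \<times> T j) \<and> r j \<in> T j \<and>
        (\<forall>v\<in>T j. finite (children E (r j) v) \<and>
                 card (children E (r j) v) = d (depth E (r j) v) j))"

definition closed_nbhd :: "'v rel \<Rightarrow> 'v set \<Rightarrow> 'v set" where
  "closed_nbhd E X = X \<union> E `` X"

text \<open>\<open>F t\<close> and \<open>P t\<close> are the sets of burning and of protected vertices at turn \<open>t\<close>. Turns are
  numbered from 1, so \<open>F 0\<close> and \<open>P 0\<close> carry no meaning. At most \<open>k\<close> vertices are protected on every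
  even turn.\<close>

definition firefighter_process ::
    "nat \<Rightarrow> 'v set \<Rightarrow> 'v rel \<Rightarrow> 'v set \<Rightarrow> (nat \<Rightarrow> 'v set) \<Rightarrow> (nat \<Rightarrow> 'v set) \<Rightarrow> bool" where
  "firefighter_process k V E F0 F P \<longleftrightarrow>
     F 1 = F0 \<and> P 1 = {} \<and>
     (\<forall>t\<ge>1. (\<exists>S. S \<subseteq> V - F (2 * t - 1) \<and> finite S \<and> card S \<le> k \<and> P (2 * t) = P (2 * t - 1) \<union> S)
             \<and> F (2 * t) = F (2 * t - 1)) \<and>
     (\<forall>t\<ge>1. F (2 * t + 1) = closed_nbhd E (F (2 * t)) - P (2 * t) \<and> P (2 * t + 1) = P (2 * t))"

definition component_avoiding :: "'v set \<Rightarrow> 'v rel \<Rightarrow> 'v set \<Rightarrow> 'v \<Rightarrow> 'v set" where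
  "component_avoiding V E X v = {w. (v, w) \<in> (E \<inter> (V - X) \<times> (V - X))\<^sup>*}"

text \<open>The set of saved vertices, given the set \<open>B\<close> of burning and the set \<open>X\<close> of protected ones.\<close>

definition saved :: "'v set \<Rightarrow> 'v rel \<Rightarrow> 'v set \<Rightarrow> 'v set \<Rightarrow> 'v set" where
  "saved V E B X = {v \<in> V. v \<in> X \<or> component_avoiding V E X v \<inter> B = {}}"

definition containable :: "nat \<Rightarrow> 'v set \<Rightarrow> 'v rel \<Rightarrow> 'v set \<Rightarrow> bool" where
  "containable k V E F0 \<longleftrightarrow>
     (\<exists>F P. firefighter_process k V E F0 F P \<and> (\<exists>t\<ge>1. finite (V - saved V E (F t) (P t))))"

end

theory Submission
  imports Defs
begin

text \<open>
  The only way to cut a vertex of a rooted tree off from its burning root is to protect one of its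
  ancestors, so at any turn the saved vertices are those that have a protected ancestor, the vertex
  itself included (\<open>saved_iff_anc\<close>). Whether the fire is contained is thus a question of
  covering all vertices of some depth \<open>N\<close> by subtrees with protected roots.

  A vertex at depth \<open>h\<close> has \<open>d h * \<dots> * d (N - 1)\<close> descendants at depth \<open>N\<close>. If a containing
  strategy is given, all vertices at depth \<open>N\<close> lie below topmost protected vertices. Nothing above
  a topmost protected vertex stops the fire, which descends one level per odd turn; hence such a
  vertex can be protected on turn \<open>2 i\<close> only if its depth is at least \<open>i\<close>
  (\<open>topmost_protected_level\<close>). It therefore covers at most \<open>d i * \<dots> * d (N - 1)\<close> vertices
  at depth \<open>N\<close>. Adding up over all turns gives the inequality, where \<open>p i j\<close> counts the vertices of
  tree \<open>j\<close> that become protected on turn \<open>2 i\<close> (\<open>contained_imp_balance\<close>).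

  Conversely, the vectors \<open>p i\<close> prescribe a greedy strategy: on turn \<open>2 i\<close>, protect \<open>p i j\<close> vertices
  at depth \<open>i\<close> of tree \<open>j\<close> that have no protected ancestor yet, or all of them if there are fewer.
  The number of exposed vertices at depth \<open>i\<close> then obeys the recursion
  \<open>a (i + 1) = d i * a i - p (i + 1)\<close>, cut off at zero. Without the cut-off its solution is the
  left-hand side of the inequality, so the exposed vertices have run out at depth \<open>t + 1\<close>
  (\<open>balance_imp_containable\<close>).
\<close>

section \<open>Rooted trees\<close>

lemma is_path_snoc:
  assumes "is_path E u p v" "(v, w) \<in> E" "w \<notin> set p"
  shows "is_path E u (p @ [w]) w"
  using assms by (auto simp: is_path_def successively_append_iff hd_append)

lemma is_path_prefix:
  assumes "is_path E u (xs @ w # ys) v"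
  shows "is_path E u (xs @ [w]) w"
  using assms by (cases xs) (auto simp: is_path_def successively_append_iff successively_Cons
      hd_append)

lemma tree_path_unique:
  assumes "tree V E" "u \<in> V" "v \<in> V" "is_path E u p v" "is_path E u q v"
  shows "p = q"
  using assms unfolding tree_def by blast

lemma tree_path_exists:
  assumes "tree V E" "u \<in> V" "v \<in> V"
  obtains p where "is_path E u p v"
  using assms unfolding tree_def by blast

lemma tree_edge_in:
  assumes "tree V E" "(v, w) \<in> E"
  shows "v \<in> V" "w \<in> V" "(w, v) \<in> E" "v \<noteq> w"
  using assms unfolding tree_def simple_graph_def sym_def irrefl_def by blast+

text \<open>Uniqueness of paths makes one of the two endpoints of an edge the parent of the other: if the path
  to \<open>v\<close> passes through \<open>w\<close>, cutting it at \<open>w\<close> gives the path to \<open>w\<close>, which avoids \<open>v\<close>;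
  otherwise the edge prolongs the path to \<open>v\<close>.\<close>

lemma tree_edge_extends_path:
  assumes tree: "tree V E" and r: "r \<in> V" and e: "(v, w) \<in> E"
    and p: "is_path E r p v" and q: "is_path E r q w"
  shows "q = p @ [w] \<or> p = q @ [v]"
proof (cases "w \<in> set p")
  case False
  then show ?thesis
    using tree_path_unique[OF tree r _ q is_path_snoc[OF p e]] tree_edge_in[OF tree e] by blast
next
  case True
  then obtain xs ys where split: "p = xs @ w # ys"
    by (meson split_list)
  have "is_path E r (xs @ [w]) w"
    using p split is_path_prefix by metis
  then have q_eq: "q = xs @ [w]"
    using tree_path_unique[OF tree r _ q] tree_edge_in[OF tree e] by blast
  have "last p = v" "distinct p"
    using p by (auto simp: is_path_def)
  moreover have "v \<noteq> w"
    using tree_edge_in[OF tree e] by blast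
  ultimately have "v \<notin> set q"
    using split q_eq by (cases ys rule: rev_cases) auto
  then show ?thesis
    using tree_path_unique[OF tree r _ p is_path_snoc[OF q]] tree_edge_in[OF tree e] by blast
qed

lemma is_path_relpow:
  assumes "is_path E u p v"
  shows "(u, v) \<in> E ^^ (length p - 1)"
proof -
  have "(hd p, last p) \<in> E ^^ (length p - 1)"
    if "p \<noteq> []" "successively (\<lambda>x y. (x, y) \<in> E) p"
    using that
  proof (induction p)
    case (Cons x xs)
    then show ?case
    proof (cases xs)
      case (Cons y ys)
      then show ?thesis
        using Cons.IH Cons.prems relpow_Suc_I2[of x y E "last xs" "length ys"] by simp
    qed simp
  qed simp
  then show ?thesis
    using assms by (auto simp: is_path_def)
qed

text \<open>Along an edge the length of the path from the root changes by one, so a walk needs at least as many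
  steps as the path. This identifies \<open>depth\<close>, defined by walks, with the length of the path.\<close>

lemma tree_walk_length:
  assumes tree: "tree V E" and r: "r \<in> V"
  shows "(r, v) \<in> E ^^ n \<Longrightarrow> is_path E r p v \<Longrightarrow> length p \<le> Suc n"
proof (induction n arbitrary: v p)
  case 0
  moreover have "is_path E r [r] r"
    by (simp add: is_path_def)
  ultimately show ?case
    using tree_path_unique[OF tree r r] by fastforce
next
  case (Suc n)
  then obtain u where u: "(r, u) \<in> E ^^ n" and uv: "(u, v) \<in> E"
    by auto
  obtain q where q: "is_path E r q u"
    using tree_path_exists[OF tree r] tree_edge_in[OF tree uv] by blast
  show ?case
    using Suc.IH[OF u q] tree_edge_extends_path[OF tree r uv q Suc.prems(2)] by auto
qed

lemma tree_depth_eq: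
  assumes tree: "tree V E" and r: "r \<in> V" and p: "is_path E r p v"
  shows "Suc (depth E r v) = length p"
proof -
  have "depth E r v = length p - 1"
    unfolding depth_def
  proof (rule Least_equality)
    show "length p - 1 \<le> n" if "(r, v) \<in> E ^^ n" for n
      using tree_walk_length[OF tree r that p] by simp
  qed (rule is_path_relpow[OF p])
  then show ?thesis
    using p by (cases p) (auto simp: is_path_def)
qed

section \<open>Forests with levels\<close>

text \<open>What the fire argument uses of a forest: \<open>h v\<close> is the depth of \<open>v\<close> in its own tree and
  \<open>K v\<close> the set of its children there. Both are functions of the vertex alone, so that walks can be
  followed without mentioning the tree that contains them.\<close>

locale leveled_forest =
  fixes m :: nat and d :: "nat \<Rightarrow> nat \<Rightarrow> nat" and V :: "'v set" and E :: "'v rel"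
    and T :: "nat \<Rightarrow> 'v set" and r :: "nat \<Rightarrow> 'v" and h :: "'v \<Rightarrow> nat" and K :: "'v \<Rightarrow> 'v set"
  assumes vertices: "V = (\<Union>j\<in>{1..m}. T j)"
    and trees_disjoint: "disjoint_family_on T {1..m}"
    and root_in: "j \<in> {1..m} \<Longrightarrow> r j \<in> T j"
    and root_level: "j \<in> {1..m} \<Longrightarrow> h (r j) = 0"
    and edge_cases: "(v, w) \<in> E \<Longrightarrow> v \<in> V \<and> w \<in> V \<and> (w \<in> K v \<or> v \<in> K w)"
    and child_props: "j \<in> {1..m} \<Longrightarrow> v \<in> T j \<Longrightarrow> w \<in> K v \<Longrightarrow>
      (v, w) \<in> E \<and> (w, v) \<in> E \<and> w \<in> T j \<and> h w = Suc (h v)"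
    and parent_unique: "v \<in> V \<Longrightarrow> v' \<in> V \<Longrightarrow> w \<in> K v \<Longrightarrow> w \<in> K v' \<Longrightarrow> v = v'"
    and parent_exists: "j \<in> {1..m} \<Longrightarrow> v \<in> T j \<Longrightarrow> v \<noteq> r j \<Longrightarrow> \<exists>u\<in>T j. v \<in> K u"
    and children_count: "j \<in> {1..m} \<Longrightarrow> v \<in> T j \<Longrightarrow> finite (K v) \<and> card (K v) = d (h v) j"

text \<open>Paths and tree-ness speak of the edges inside one tree, depths and children of all edges.
  The two agree because no edge leaves a tree. With the path to each vertex at hand, \<open>w\<close> is a child
  of \<open>v\<close> exactly if appending \<open>w\<close> to the path of \<open>v\<close> gives the path of \<open>w\<close>.\<close>

lemma generated_forest_leveled:
  assumes gf: "generated_forest m d V E T r"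
  obtains h K where "leveled_forest m d V E T r h K"
proof -
  have V: "V = (\<Union>j\<in>{1..m}. T j)" and disj: "disjoint_family_on T {1..m}"
    and E: "E \<subseteq> (\<Union>j\<in>{1..m}. T j \<times> T j)"
    and tree: "\<And>j. j \<in> {1..m} \<Longrightarrow> tree (T j) (E \<inter> T j \<times> T j)"
    and root: "\<And>j. j \<in> {1..m} \<Longrightarrow> r j \<in> T j"
    and count: "\<And>j v. j \<in> {1..m} \<Longrightarrow> v \<in> T j \<Longrightarrow> finite (children E (r j) v) \<and>
                 card (children E (r j) v) = d (depth E (r j) v) j"
    using gf unfolding generated_forest_def by blast+
  have same: "i = j" if "i \<in> {1..m}" "j \<in> {1..m}" "v \<in> T i" "v \<in> T j" for i j v
    using disj that unfolding disjoint_family_on_def by blast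
  define idx where "idx v = (THE j. j \<in> {1..m} \<and> v \<in> T j)" for v
  have idx: "idx v = j" if "j \<in> {1..m}" "v \<in> T j" for v j
    unfolding idx_def using that same by blast
  define h where "h v = depth E (r (idx v)) v" for v
  define K where "K v = children E (r (idx v)) v" for v
  let ?E = "\<lambda>j. E \<inter> T j \<times> T j"
  have edge_tree: "(v, w) \<in> ?E j" if "j \<in> {1..m}" "v \<in> T j \<or> w \<in> T j" "(v, w) \<in> E" for j v w
    using E that same by blast
  have "(r j, v) \<in> E ^^ n \<longleftrightarrow> (r j, v) \<in> ?E j ^^ n" if j: "j \<in> {1..m}" for j v n
  proof -
    have "(r j, v) \<in> ?E j ^^ n \<and> v \<in> T j" if "(r j, v) \<in> E ^^ n"
      using that
    proof (induction n arbitrary: v)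
      case 0
      then show ?case using root[OF j] by simp
    next
      case (Suc n)
      then obtain u where u: "(r j, u) \<in> E ^^ n" "(u, v) \<in> E"
        by auto
      with Suc.IH have "(r j, u) \<in> ?E j ^^ n" "u \<in> T j" by auto
      moreover from this u edge_tree[OF j] have "(u, v) \<in> ?E j" by blast
      ultimately show ?case by auto
    qed
    moreover have "(r j, v) \<in> E ^^ n" if "(r j, v) \<in> ?E j ^^ n"
      using that by (induction n arbitrary: v) auto
    ultimately show ?thesis by blast
  qed
  then have depth: "depth E (r j) v = depth (?E j) (r j) v" if "j \<in> {1..m}" for j v
    using that unfolding depth_def by simp
  have level: "Suc (h v) = length p" if "j \<in> {1..m}" "v \<in> T j" "is_path (?E j) (r j) p v" for j v p
    using tree_depth_eq[OF tree[OF that(1)] root[OF that(1)] that(3)] depth[OF that(1)]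
      idx[OF that(1,2)] unfolding h_def by simp
  have K_iff: "w \<in> K v \<longleftrightarrow> (v, w) \<in> E \<and> q = p @ [w]"
    if j: "j \<in> {1..m}" and v: "v \<in> T j" and w: "w \<in> T j"
      and p: "is_path (?E j) (r j) p v" and q: "is_path (?E j) (r j) q w" for j v w p q
  proof -
    have "w \<in> K v \<longleftrightarrow> (v, w) \<in> E \<and> h w = Suc (h v)"
      using idx[OF j] v w unfolding K_def children_def h_def by auto
    moreover have "q = p @ [w] \<or> p = q @ [v]" if "(v, w) \<in> E"
      using tree_edge_extends_path[OF tree[OF j] root[OF j] _ p q] edge_tree[OF j _ that] v
      by blast
    ultimately show ?thesis
      using level[OF j v p] level[OF j w q] by auto
  qed
  have child: "(v, w) \<in> E \<and> (w, v) \<in> E \<and> w \<in> T j \<and> h w = Suc (h v)"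
    if j: "j \<in> {1..m}" and v: "v \<in> T j" and w: "w \<in> K v" for j v w
  proof -
    have vw: "(v, w) \<in> E"
      using w unfolding K_def children_def by blast
    then have vw': "(v, w) \<in> ?E j"
      using edge_tree[OF j] v by blast
    then show ?thesis
      using w vw v idx[OF j] tree_edge_in[OF tree[OF j] vw']
      unfolding K_def children_def h_def by auto
  qed
  have path: "\<exists>p. is_path (?E j) (r j) p v" if "j \<in> {1..m}" "v \<in> T j" for j v
    using tree_path_exists[OF tree root] that by metis
  have "leveled_forest m d V E T r h K"
  proof
    show "h (r j) = 0" if "j \<in> {1..m}" for j
      using level[OF that root[OF that], of "[r j]"] by (simp add: is_path_def)
    show "v \<in> V \<and> w \<in> V \<and> (w \<in> K v \<or> v \<in> K w)" if vw: "(v, w) \<in> E" for v w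
    proof -
      obtain j where j: "j \<in> {1..m}" "v \<in> T j" "w \<in> T j"
        using E vw by blast
      then have vw': "(v, w) \<in> ?E j"
        using vw by blast
      obtain p q where pq: "is_path (?E j) (r j) p v" "is_path (?E j) (r j) q w"
        using path j by meson
      have "q = p @ [w] \<or> p = q @ [v]"
        using tree_edge_extends_path[OF tree[OF j(1)] root[OF j(1)] vw' pq] .
      then show ?thesis
        using j V vw tree_edge_in[OF tree[OF j(1)] vw'] K_iff[OF j pq]
          K_iff[OF j(1,3,2) pq(2,1)] by blast
    qed
    show "v = v'" if vV: "v \<in> V" "v' \<in> V" and kids: "w \<in> K v" "w \<in> K v'" for v v' w
    proof -
      obtain j where j: "j \<in> {1..m}" "v \<in> T j" using V vV(1) by blast
      then have w: "w \<in> T j" using child kids(1) by blast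
      obtain i where i: "i \<in> {1..m}" "v' \<in> T i" using V vV(2) by blast
      then have "i = j" using child kids(2) w same j(1) by blast
      with i have v': "v' \<in> T j" by simp
      obtain p p' q where p: "is_path (?E j) (r j) p v" and p': "is_path (?E j) (r j) p' v'"
        and q: "is_path (?E j) (r j) q w"
        using path j w v' by meson
      have "p = p'"
        using K_iff[OF j w p q] K_iff[OF j(1) v' w p' q] kids by auto
      then show ?thesis
        using p p' unfolding is_path_def by blast
    qed
    show "\<exists>u\<in>T j. v \<in> K u" if j: "j \<in> {1..m}" and v: "v \<in> T j" and "v \<noteq> r j" for j v
    proof -
      obtain p where p: "is_path (?E j) (r j) p v"
        using path j v by blast
      then obtain xs where xs: "p = xs @ [v]"
        unfolding is_path_def by (metis append_butlast_last_id)
      with p \<open>v \<noteq> r j\<close> obtain ys u where ys: "xs = ys @ [u]"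
        by (cases xs rule: rev_cases) (auto simp: is_path_def)
      have uv: "(u, v) \<in> ?E j"
        using p xs ys by (auto simp: is_path_def successively_append_iff)
      have "is_path (?E j) (r j) (ys @ [u]) u"
        using p xs ys is_path_prefix[of "?E j" "r j" ys u "[v]" v] by simp
      with K_iff[OF j _ v _ p] uv xs ys show ?thesis
        by blast
    qed
    show "finite (K v) \<and> card (K v) = d (h v) j" if "j \<in> {1..m}" "v \<in> T j" for j v
      using count[OF that] idx[OF that] unfolding K_def h_def by simp
  qed (use V disj root child in blast)+
  then show ?thesis
    using that by blast
qed

context leveled_forest
begin

lemma tree_of:
  assumes "v \<in> V"
  obtains j where "j \<in> {1..m}" "v \<in> T j"
  using assms vertices by blast

lemma tree_sub: "j \<in> {1..m} \<Longrightarrow> v \<in> T j \<Longrightarrow> v \<in> V"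
  using vertices by blast

lemma vertex_induct [consumes 2, case_names root child]:
  assumes j: "j \<in> {1..m}" and "v \<in> T j"
    and root: "P (r j)"
    and step: "\<And>u w. u \<in> T j \<Longrightarrow> w \<in> K u \<Longrightarrow> w \<in> T j \<Longrightarrow> P u \<Longrightarrow> P w"
  shows "P v"
  using \<open>v \<in> T j\<close>
proof (induction "h v" arbitrary: v rule: less_induct)
  case less
  show ?case
  proof (cases "v = r j")
    case False
    then obtain u where u: "u \<in> T j" "v \<in> K u"
      using parent_exists j less.prems by blast
    then have "h u < h v"
      using child_props[OF j] by simp
    then show ?thesis
      using less.hyps u less.prems step by blast
  qed (simp add: root)
qed

definition anc :: "'v \<Rightarrow> 'v set" where
  "anc w = {u. (u, w) \<in> {(v, w). v \<in> V \<and> w \<in> K v}\<^sup>*}"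

lemma anc_self [simp]: "v \<in> anc v"
  by (simp add: anc_def)

lemma anc_root:
  assumes j: "j \<in> {1..m}"
  shows "anc (r j) = {r j}"
proof -
  have "r j \<notin> K v" if v: "v \<in> V" for v
  proof -
    obtain i where "i \<in> {1..m}" "v \<in> T i"
      by (rule tree_of[OF v])
    then show ?thesis
      using child_props root_level[OF j] by fastforce
  qed
  then have "u = r j" if "(u, r j) \<in> {(v, w). v \<in> V \<and> w \<in> K v}\<^sup>*" for u
    using rtranclE[OF that] by auto
  then show ?thesis
    unfolding anc_def by blast
qed

lemma anc_child:
  assumes v: "v \<in> V" and w: "w \<in> K v"
  shows "anc w = insert w (anc v)"
proof -
  let ?R = "{(v, w). v \<in> V \<and> w \<in> K v}"
  have "u = w \<or> (u, v) \<in> ?R\<^sup>*" if "(u, w) \<in> ?R\<^sup>*" for u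
  proof (rule rtranclE[OF that])
    fix y
    assume y: "(u, y) \<in> ?R\<^sup>*" "(y, w) \<in> ?R"
    then have "y = v"
      using parent_unique[of y v w] v w by simp
    then show ?thesis
      using y(1) by simp
  qed simp
  moreover have "(v, w) \<in> ?R"
    using v w by simp
  then have "(u, w) \<in> ?R\<^sup>*" if "(u, v) \<in> ?R\<^sup>*" for u
    using that by (rule rtrancl_into_rtrancl[rotated])
  ultimately show ?thesis
    unfolding anc_def by blast
qed

lemma anc_trans: "u \<in> anc v \<Longrightarrow> anc u \<subseteq> anc v"
  unfolding anc_def by (auto intro: rtrancl_trans)

lemma anc_level:
  assumes j: "j \<in> {1..m}" and "v \<in> T j" and "u \<in> anc v"
  shows "u \<in> T j \<and> h u \<le> h v \<and> (h u = h v \<longrightarrow> u = v)"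
  using assms
proof (induction rule: vertex_induct)
  case root
  then have "u = r j"
    using anc_root[OF j] by simp
  then show ?case
    using root_in[OF j] by simp
next
  case (child w x)
  have "u = x \<or> u \<in> anc w"
    using anc_child[OF tree_sub[OF j child(1)] child(2)] child.prems by simp
  moreover have "h x = Suc (h w)"
    using child_props[OF j child(1,2)] by simp
  ultimately show ?case
    using child(3) child.IH by auto
qed

lemma anc_at_level:
  assumes j: "j \<in> {1..m}" and "v \<in> T j" and "n \<le> h v"
  shows "\<exists>u\<in>anc v. h u = n"
  using assms
proof (induction rule: vertex_induct)
  case root
  then show ?case
    using anc_root[OF j] root_level[OF j] by simp
next
  case (child w x)
  have anc: "anc x = insert x (anc w)"
    by (rule anc_child[OF tree_sub[OF j child(1)] child(2)])
  have h: "h x = Suc (h w)"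
    using child_props[OF j child(1,2)] by simp
  show ?case
  proof (cases "n = h x")
    case False
    then have "\<exists>u\<in>anc w. h u = n"
      using child.IH child.prems h by simp
    then show ?thesis
      unfolding anc by blast
  qed (auto simp: anc)
qed

definition level :: "nat \<Rightarrow> nat \<Rightarrow> 'v set" where
  "level j n = {v \<in> T j. h v = n}"

lemma level_0:
  assumes j: "j \<in> {1..m}"
  shows "level j 0 = {r j}"
proof -
  have "v = r j" if v: "v \<in> T j" "h v = 0" for v
  proof (rule ccontr)
    assume "v \<noteq> r j"
    then obtain u where "u \<in> T j" "v \<in> K u"
      using parent_exists[OF j] v by blast
    then show False
      using child_props[OF j] v by fastforce
  qed
  then show ?thesis
    using root_in[OF j] root_level[OF j] unfolding level_def by blast
qed

lemma level_Suc:
  assumes j: "j \<in> {1..m}"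
  shows "level j (Suc n) = (\<Union>v\<in>level j n. K v)"
proof
  show "level j (Suc n) \<subseteq> (\<Union>v\<in>level j n. K v)"
  proof
    fix v
    assume v: "v \<in> level j (Suc n)"
    then have "v \<in> T j" "v \<noteq> r j"
      using root_level[OF j] unfolding level_def by auto
    then obtain u where "u \<in> T j" "v \<in> K u"
      using parent_exists[OF j] by blast
    then show "v \<in> (\<Union>v\<in>level j n. K v)"
      using child_props[OF j] v unfolding level_def by auto
  qed
  show "(\<Union>v\<in>level j n. K v) \<subseteq> level j (Suc n)"
    using child_props[OF j] unfolding level_def by auto
qed

lemma card_children:
  assumes j: "j \<in> {1..m}" and A: "A \<subseteq> level j n" and fin: "finite A"
  shows "finite (\<Union>v\<in>A. K v)" "card (\<Union>v\<in>A. K v) = d n j * card A"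
proof -
  have A': "finite (K v)" "card (K v) = d n j" "v \<in> V" if "v \<in> A" for v
    using A that children_count[OF j] tree_sub[OF j] unfolding level_def by auto
  have "card (\<Union>v\<in>A. K v) = (\<Sum>v\<in>A. card (K v))"
  proof (rule card_UN_disjoint[OF fin])
    show "\<forall>v\<in>A. \<forall>w\<in>A. v \<noteq> w \<longrightarrow> K v \<inter> K w = {}"
      using A'(3) parent_unique by (meson disjoint_iff)
  qed (use A'(1) in blast)
  then show "card (\<Union>v\<in>A. K v) = d n j * card A"
    using A' by simp
  show "finite (\<Union>v\<in>A. K v)"
    using fin A' by blast
qed

text \<open>From one level to the next, the set of descendants of \<open>u\<close> is replaced by the disjoint union of
  their sets of children.\<close>

lemma card_descendants:
  assumes j: "j \<in> {1..m}" and u: "u \<in> T j" and "h u \<le> N"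
  shows "finite {v \<in> level j N. u \<in> anc v} \<and>
    card {v \<in> level j N. u \<in> anc v} = (\<Prod>l\<in>{h u..<N}. d l j)"
  using \<open>h u \<le> N\<close>
proof (induction N rule: dec_induct)
  case base
  have "v = u" if "v \<in> T j" "h v = h u" "u \<in> anc v" for v
    using anc_level[OF j that(1,3)] that(2) by simp
  then have "{v \<in> level j (h u). u \<in> anc v} = {u}"
    using u by (auto simp: level_def)
  then show ?case by simp
next
  case (step N)
  let ?D = "\<lambda>N. {v \<in> level j N. u \<in> anc v}"
  have "u \<in> anc w \<longleftrightarrow> u \<in> anc v" if v: "v \<in> level j N" and w: "w \<in> K v" for v w
  proof -
    have vT: "v \<in> T j" and "h v = N"
      using v unfolding level_def by auto
    then have "h w \<noteq> h u"
      using child_props[OF j vT w] step.hyps by simp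
    then show ?thesis
      using anc_child[OF tree_sub[OF j vT] w] by auto
  qed
  then have D: "?D (Suc N) = (\<Union>v\<in>?D N. K v)"
    unfolding level_Suc[OF j] by blast
  have "finite (?D (Suc N))" "card (?D (Suc N)) = d N j * card (?D N)"
    unfolding D using card_children[OF j, of "?D N" N] step.IH by auto
  then show ?case
    using step.IH step.hyps by (simp add: prod.atLeastLessThan_Suc mult.commute)
qed

lemma card_level:
  assumes j: "j \<in> {1..m}"
  shows "finite (level j N)" "card (level j N) = (\<Prod>l<N. d l j)"
proof -
  have "r j \<in> anc v" if v: "v \<in> T j" for v
  proof -
    obtain u where "u \<in> anc v" "h u = 0"
      using anc_at_level[OF j v, of 0] by blast
    moreover from this have "u \<in> level j 0"
      using anc_level[OF j v] unfolding level_def by simp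
    ultimately show ?thesis
      using level_0[OF j] by simp
  qed
  then have "{v \<in> level j N. r j \<in> anc v} = level j N"
    unfolding level_def by auto
  then show "finite (level j N)" "card (level j N) = (\<Prod>l<N. d l j)"
    using card_descendants[OF j root_in[OF j], of N] root_level[OF j]
    by (simp_all add: atLeast0LessThan)
qed

lemma finite_below: "finite {v \<in> V. h v < n}"
proof -
  have "{v \<in> V. h v < n} \<subseteq> (\<Union>j\<in>{1..m}. \<Union>i\<in>{..<n}. level j i)"
    unfolding vertices level_def by blast
  then show ?thesis
    by (rule finite_subset) (intro finite_UN_I finite_atLeastAtMost finite_lessThan card_level)
qed

section \<open>Fire on a forest\<close>

text \<open>Going down an edge adds only the new vertex to the set of ancestors, going up removes one. Hence a
  walk that avoids \<open>X\<close> cannot get below a vertex of \<open>X\<close>.\<close>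

lemma anc_free_edge:
  assumes e: "(v, w) \<in> E" and "w \<notin> X" "anc v \<inter> X = {}"
  shows "anc w \<inter> X = {}"
proof -
  have "anc w = insert w (anc v) \<or> anc v = insert v (anc w)"
    using edge_cases[OF e] anc_child by meson
  then show ?thesis
    using assms by auto
qed

lemma anc_free_connected:
  assumes j: "j \<in> {1..m}" and "v \<in> T j" and "anc v \<inter> X = {}"
  shows "(v, r j) \<in> (E \<inter> (V - X) \<times> (V - X))\<^sup>*"
  using assms
proof (induction rule: vertex_induct)
  case (child u w)
  have "anc w = insert w (anc u)"
    by (rule anc_child[OF tree_sub[OF j child(1)] child(2)])
  then have free: "anc u \<inter> X = {}" and "w \<notin> X"
    using child.prems by auto
  moreover have "u \<notin> X"
    using free anc_self[of u] by (meson disjoint_iff)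
  moreover have "(w, u) \<in> E" "u \<in> V" "w \<in> V"
    using child_props[OF j child(1,2)] tree_sub[OF j] child(1,3) by auto
  ultimately have "(w, u) \<in> E \<inter> (V - X) \<times> (V - X)"
    by simp
  then show ?case
    using child.IH[OF free] by (rule converse_rtrancl_into_rtrancl)
qed simp

end

locale forest_fire = leveled_forest +
  fixes k :: nat and F P :: "nat \<Rightarrow> 'a set"
  assumes process: "firefighter_process k V E (r ` {1..m}) F P"
begin

lemma fire_1: "F (Suc 0) = r ` {1..m}" and prot_1: "P (Suc 0) = {}"
  using process unfolding firefighter_process_def by auto

lemma even_turn:
  obtains S where "S \<subseteq> V - F (Suc (2 * n))" "finite S" "card S \<le> k"
    "P (Suc (Suc (2 * n))) = P (Suc (2 * n)) \<union> S" "F (Suc (Suc (2 * n))) = F (Suc (2 * n))"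
proof -
  have "1 \<le> Suc n" "2 * Suc n = Suc (Suc (2 * n))" "2 * Suc n - 1 = Suc (2 * n)"
    by auto
  then show ?thesis
    using process that unfolding firefighter_process_def by metis
qed

lemma odd_turn:
  "F (Suc (Suc (Suc (2 * n)))) = closed_nbhd E (F (Suc (Suc (2 * n)))) - P (Suc (Suc (2 * n)))"
  "P (Suc (Suc (Suc (2 * n)))) = P (Suc (Suc (2 * n)))"
proof -
  have "1 \<le> Suc n" "2 * Suc n = Suc (Suc (2 * n))" "2 * Suc n + 1 = Suc (Suc (Suc (2 * n)))"
    by auto
  then show
    "F (Suc (Suc (Suc (2 * n)))) = closed_nbhd E (F (Suc (Suc (2 * n)))) - P (Suc (Suc (2 * n)))"
    "P (Suc (Suc (Suc (2 * n)))) = P (Suc (Suc (2 * n)))"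
    using process unfolding firefighter_process_def by metis+
qed

lemma turn_cases:
  fixes t :: nat
  assumes "t \<ge> 1"
  shows "\<exists>n. t = Suc (2 * n) \<or> t = Suc (Suc (2 * n))"
proof -
  obtain s where s: "t = Suc s"
    using assms by (cases t) auto
  show ?thesis
    by (cases "even s") (auto simp: s elim!: evenE oddE)
qed

text \<open>The turns are 1, then alternately even and odd; the successor form lets the three cases be matched
  without arithmetic.\<close>

lemma turn_induct [consumes 1, case_names first even odd]:
  assumes "t \<ge> 1" and first: "Q (Suc 0)"
    and even: "\<And>n. Q (Suc (2 * n)) \<Longrightarrow> Q (Suc (Suc (2 * n)))"
    and odd: "\<And>n. Q (Suc (Suc (2 * n))) \<Longrightarrow> Q (Suc (Suc (Suc (2 * n))))"
  shows "Q t"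
proof -
  have "Q (Suc (2 * n)) \<and> Q (Suc (Suc (2 * n)))" for n
  proof (induction n)
    case 0
    show ?case
      using first even[of 0] by simp
  next
    case (Suc n)
    then show ?case
      using odd[of n] even[of "Suc n"] by simp
  qed
  then show ?thesis
    using turn_cases[OF \<open>t \<ge> 1\<close>] by blast
qed

text \<open>The fire reaches a vertex only from its parent, because the set of burning vertices is closed under
  taking ancestors: a neighbour that is a child of the new vertex cannot burn before it.\<close>

lemma burning_invariant:
  assumes "t \<ge> 1"
  shows "r ` {1..m} \<subseteq> F t \<and> F t \<subseteq> V \<and> F t \<inter> P t = {} \<and> (\<forall>b\<in>F t. anc b \<subseteq> F t)"
  using assms
proof (induction rule: turn_induct)
  case first
  have "anc b \<subseteq> r ` {1..m}" "b \<in> V" if "b \<in> r ` {1..m}" for b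
    using that anc_root tree_sub root_in by auto
  then show ?case
    unfolding fire_1 prot_1 by blast
next
  case (even n)
  obtain S where "S \<subseteq> V - F (Suc (2 * n))"
    "P (Suc (Suc (2 * n))) = P (Suc (2 * n)) \<union> S" "F (Suc (Suc (2 * n))) = F (Suc (2 * n))"
    by (rule even_turn)
  with even show ?case
    by auto
next
  case (odd n)
  let ?F = "F (Suc (Suc (2 * n)))" and ?P = "P (Suc (Suc (2 * n)))"
  let ?F' = "F (Suc (Suc (Suc (2 * n))))"
  have mono: "?F \<subseteq> ?F'"
    using odd unfolding odd_turn closed_nbhd_def by auto
  have "b \<in> V \<and> anc b \<subseteq> ?F'" if b: "b \<in> ?F'" for b
  proof (cases "b \<in> ?F")
    case True
    then show ?thesis
      using odd mono by (meson subset_iff)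
  next
    case False
    then obtain a where a: "a \<in> ?F" "(a, b) \<in> E"
      using b unfolding odd_turn closed_nbhd_def by auto
    then have ab: "a \<in> V" "b \<in> V" "b \<in> K a \<or> a \<in> K b"
      using edge_cases[OF a(2)] by auto
    have anc_a: "anc a \<subseteq> ?F"
      using odd a(1) by simp
    have "a \<notin> K b"
    proof
      assume "a \<in> K b"
      then have "b \<in> anc a"
        using anc_child[OF ab(2)] by simp
      then show False
        using anc_a False by (meson subsetD)
    qed
    then have "anc b = insert b (anc a)"
      using anc_child[OF ab(1)] ab(3) by simp
    then show ?thesis
      using anc_a b mono ab(2) by auto
  qed
  moreover have "?F' \<inter> ?P = {}"
    unfolding odd_turn by auto
  ultimately show ?case
    using odd mono odd_turn(2)[of n] by auto
qed

text \<open>If no ancestor of \<open>v\<close> is protected, the path up to the root joins \<open>v\<close> to a burning vertex. If some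
  ancestor is, no walk can lead to a burning vertex, as all ancestors of that one burn and so
  are unprotected.\<close>

lemma saved_iff_anc:
  assumes t: "t \<ge> 1" and v: "v \<in> V"
  shows "v \<in> saved V E (F t) (P t) \<longleftrightarrow> anc v \<inter> P t \<noteq> {}"
proof
  note inv = burning_invariant[OF t]
  assume s: "v \<in> saved V E (F t) (P t)"
  show "anc v \<inter> P t \<noteq> {}"
  proof
    assume free: "anc v \<inter> P t = {}"
    obtain j where j: "j \<in> {1..m}" "v \<in> T j"
      using tree_of v by blast
    have "r j \<in> component_avoiding V E (P t) v \<inter> F t"
      using anc_free_connected[OF j free] inv j(1) unfolding component_avoiding_def by blast
    moreover have "v \<notin> P t"
      using free anc_self by blast
    ultimately show False
      using s unfolding saved_def by blast
  qed
next
  note inv = burning_invariant[OF t]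
  assume a: "anc v \<inter> P t \<noteq> {}"
  have "anc v \<inter> P t = {}"
    if "(v, b) \<in> (E \<inter> (V - P t) \<times> (V - P t))\<^sup>*" "b \<in> F t" for b
    using that(1)
  proof (induction rule: converse_rtrancl_induct)
    case base
    then show ?case using inv that(2) by blast
  next
    case (step x y)
    then have "(y, x) \<in> E"
      using edge_cases[of x y] child_props by (metis IntD1 tree_of)
    then show ?case
      using anc_free_edge step by blast
  qed
  then show "v \<in> saved V E (F t) (P t)"
    using a v unfolding saved_def component_avoiding_def by blast
qed

lemma prot_Suc: "t \<ge> 1 \<Longrightarrow> P t \<subseteq> P (Suc t)"
proof -
  have "P (Suc (2 * n)) \<subseteq> P (Suc (Suc (2 * n)))" for n
    by (rule even_turn[of n]) blast
  moreover have "P (Suc (Suc (2 * n))) \<subseteq> P (Suc (Suc (Suc (2 * n))))" for n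
    using odd_turn(2)[of n] by simp
  moreover assume "t \<ge> 1"
  ultimately show ?thesis
    using turn_cases[of t] by metis
qed

lemma prot_mono:
  assumes "s \<ge> 1" "s \<le> t"
  shows "P s \<subseteq> P t"
  using assms(2) by (induction rule: dec_induct) (use prot_Suc assms(1) in \<open>auto intro: order_trans\<close>)

text \<open>The fire descends one level per odd turn where nothing stops it.\<close>

lemma unprotected_burns:
  assumes "v \<in> V" "h v \<le> n" "anc v \<inter> P (Suc (2 * n)) = {}"
  shows "v \<in> F (Suc (2 * n))"
  using assms
proof (induction n arbitrary: v)
  case 0
  then obtain j where "j \<in> {1..m}" "v \<in> T j"
    using tree_of by blast
  then show ?case
    using level_0[of j] 0 fire_1 unfolding level_def by auto
next
  case (Suc n)
  obtain j where j: "j \<in> {1..m}" "v \<in> T j"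
    using tree_of Suc.prems by blast
  show ?case
  proof (cases "v = r j")
    case True
    then show ?thesis
      using burning_invariant[of "Suc (2 * Suc n)"] j by auto
  next
    case False
    then obtain u where u: "u \<in> T j" "v \<in> K u"
      using parent_exists j by blast
    then have "u \<in> V" "(u, v) \<in> E" "h u \<le> n" "anc v = insert v (anc u)"
      using anc_child tree_sub[OF j(1)] child_props[OF j(1)] Suc.prems(2) by auto
    moreover have "P (Suc (2 * n)) \<subseteq> P (Suc (2 * Suc n))"
      by (rule prot_mono) auto
    ultimately have "u \<in> F (Suc (2 * n))"
      using Suc by blast
    then have "u \<in> F (Suc (Suc (2 * n)))"
      by (metis even_turn)
    moreover have "v \<notin> P (Suc (Suc (2 * n)))"
      using Suc.prems(3) odd_turn(2)[of n] by (auto simp: disjoint_iff)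
    ultimately show ?thesis
      using odd_turn(1)[of n] \<open>(u, v) \<in> E\<close> unfolding closed_nbhd_def by auto
  qed
qed

end

section \<open>The balance\<close>

text \<open>The number of exposed vertices at depth \<open>n\<close> of a tree with birth sequence \<open>d\<close> if
  \<open>p i\<close> exposed vertices are protected at each depth \<open>i\<close> from 1 to \<open>n\<close>. A negative value stands for
  a surplus of protections.\<close>

definition balance :: "(nat \<Rightarrow> nat) \<Rightarrow> (nat \<Rightarrow> nat) \<Rightarrow> nat \<Rightarrow> int" where
  "balance d p n = (\<Prod>l<n. int (d l)) - (\<Sum>i=1..n. int (p i) * (\<Prod>l=i..<n. int (d l)))"

lemma balance_0: "balance d p 0 = 1"
  by (simp add: balance_def)

lemma balance_Suc: "balance d p (Suc n) = int (d n) * balance d p n - int (p (Suc n))"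
  by (simp add: balance_def algebra_simps sum_distrib_left sum_distrib_right)

lemma balance_conv:
  "balance d p (t + 1) = (\<Prod>i=0..t. int (d i))
     - (\<Sum>i=1..t. int (p i) * (\<Prod>l=i..t. int (d l))) - int (p (t + 1))"
  by (simp add: balance_def atLeast0LessThan[symmetric] atLeastLessThanSuc_atLeastAtMost)


section \<open>Containment forces a non-positive balance\<close>

context forest_fire
begin

definition newly_protected :: "nat \<Rightarrow> 'a set" where
  "newly_protected n = P (Suc (Suc (2 * n))) - P (Suc (2 * n))"

lemma newly_protected_props:
  "newly_protected n \<subseteq> V - F (Suc (2 * n))" "finite (newly_protected n)"
  "card (newly_protected n) \<le> k"
proof -
  obtain S where S: "S \<subseteq> V - F (Suc (2 * n))" "finite S" "card S \<le> k"
    "P (Suc (Suc (2 * n))) = P (Suc (2 * n)) \<union> S"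
    by (rule even_turn)
  then have sub: "newly_protected n \<subseteq> S"
    unfolding newly_protected_def by auto
  show "newly_protected n \<subseteq> V - F (Suc (2 * n))"
    using sub S(1) by (rule order_trans)
  show "finite (newly_protected n)"
    using sub S(2) by (rule finite_subset)
  show "card (newly_protected n) \<le> k"
    using card_mono[OF S(2) sub] S(3) by simp
qed

lemma protected_eq: "P (Suc (2 * n)) = (\<Union>i<n. newly_protected i)"
proof (induction n)
  case 0
  then show ?case
    using prot_1 by simp
next
  case (Suc n)
  have "P (Suc (2 * Suc n)) = P (Suc (2 * n)) \<union> newly_protected n"
    using odd_turn(2)[of n] prot_Suc[of "Suc (2 * n)"] unfolding newly_protected_def by auto
  then show ?case
    unfolding Suc.IH lessThan_Suc by auto
qed

text \<open>A vertex of smaller depth with no ancestor protected so far would already burn.\<close>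

lemma topmost_protected_level:
  assumes u: "u \<in> newly_protected n" and top: "anc u \<inter> P (Suc (2 * n)) \<subseteq> {u}"
  shows "Suc n \<le> h u"
proof (rule ccontr)
  assume "\<not> Suc n \<le> h u"
  moreover have "u \<notin> P (Suc (2 * n))"
    using u unfolding newly_protected_def by simp
  with top have "anc u \<inter> P (Suc (2 * n)) = {}"
    by auto
  moreover have "u \<in> V" "u \<notin> F (Suc (2 * n))"
    using newly_protected_props(1) u by auto
  ultimately show False
    using unprotected_burns[of u n] by simp
qed

text \<open>Of the protected ancestors of \<open>v\<close> take the one closest to the root.\<close>

lemma exists_topmost_protected:
  assumes j: "j \<in> {1..m}" and v: "v \<in> T j" and prot: "anc v \<inter> P (Suc (2 * n)) \<noteq> {}"
  obtains i u where "i \<in> {1..n}" "u \<in> newly_protected (i - 1) \<inter> T j" "i \<le> h u" "u \<in> anc v"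
proof -
  obtain x where "x \<in> anc v \<inter> P (Suc (2 * n))"
    using prot by auto
  then obtain u where u: "u \<in> anc v \<inter> P (Suc (2 * n))"
    and least: "\<And>y. y \<in> anc v \<inter> P (Suc (2 * n)) \<Longrightarrow> h u \<le> h y"
    using ex_has_least_nat[of "\<lambda>y. y \<in> anc v \<inter> P (Suc (2 * n))" x h] by metis
  obtain i where i: "i < n" "u \<in> newly_protected i"
    using u unfolding protected_eq by auto
  have uT: "u \<in> T j"
    using anc_level[OF j v] u by auto
  have "P (Suc (2 * i)) \<subseteq> P (Suc (2 * n))"
    using i(1) by (intro prot_mono) auto
  then have "y \<in> anc v \<inter> P (Suc (2 * n))" if "y \<in> anc u \<inter> P (Suc (2 * i))" for y
    using anc_trans[of u v] u that by (meson IntD1 IntD2 IntI subsetD)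
  then have "y = u" if "y \<in> anc u \<inter> P (Suc (2 * i))" for y
    using anc_level[OF j uT, of y] least[of y] that by simp
  then have "Suc i \<le> h u"
    by (intro topmost_protected_level i(2)) auto
  then show ?thesis
    using that[of "Suc i" u] i uT u by auto
qed

text \<open>The subtrees of the topmost protected vertices cover level \<open>N\<close>; a vertex that became protected on
  turn \<open>2 * i\<close> has depth at least \<open>i\<close> and so covers at most the product from \<open>i\<close> on, all factors
  being at least 1.\<close>

lemma card_level_le:
  assumes j: "j \<in> {1..m}" and pos: "\<And>i. d i j > 0"
    and prot: "\<And>v. v \<in> level j N \<Longrightarrow> anc v \<inter> P (Suc (2 * N)) \<noteq> {}"
  shows "(\<Prod>l<N. d l j) \<le>
    (\<Sum>i=1..N. card (newly_protected (i - 1) \<inter> T j) * (\<Prod>l=i..<N. d l j))"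
proof -
  define A where "A i = {u \<in> newly_protected (i - 1) \<inter> T j. i \<le> h u \<and> h u \<le> N}" for i
  define D where "D u = {v \<in> level j N. u \<in> anc v}" for u
  have A: "finite (A i)" "card (A i) \<le> card (newly_protected (i - 1) \<inter> T j)" for i
    using newly_protected_props(2)[of "i - 1"] unfolding A_def
    by (auto intro!: card_mono)
  have D: "finite (D u)" "card (D u) \<le> (\<Prod>l=i..<N. d l j)" if "u \<in> A i" for i u
  proof -
    have u: "u \<in> T j" "i \<le> h u" "h u \<le> N"
      using that unfolding A_def by auto
    have "1 \<le> (\<Prod>l=i..<h u. d l j)"
      by (intro prod_ge_1) (simp add: Suc_le_eq pos)
    then have "(\<Prod>l=h u..<N. d l j) \<le> (\<Prod>l=i..<N. d l j)"
      using prod.atLeastLessThan_concat[OF u(2,3), of "\<lambda>l. d l j"]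
      by (metis mult_1 mult_le_mono1)
    then show "finite (D u)" "card (D u) \<le> (\<Prod>l=i..<N. d l j)"
      using card_descendants[OF j u(1,3)] unfolding D_def by auto
  qed
  have "level j N \<subseteq> (\<Union>i\<in>{1..N}. \<Union>u\<in>A i. D u)"
  proof
    fix v
    assume v: "v \<in> level j N"
    then have vT: "v \<in> T j" "h v = N"
      unfolding level_def by auto
    obtain i u where "i \<in> {1..N}" "u \<in> newly_protected (i - 1) \<inter> T j" "i \<le> h u" "u \<in> anc v"
      using exists_topmost_protected[OF j vT(1) prot[OF v]] by blast
    moreover from this have "h u \<le> N"
      using anc_level[OF j vT(1)] vT(2) by auto
    ultimately show "v \<in> (\<Union>i\<in>{1..N}. \<Union>u\<in>A i. D u)"
      using v unfolding A_def D_def by auto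
  qed
  moreover have "finite (\<Union>i\<in>{1..N}. \<Union>u\<in>A i. D u)"
    using A(1) D(1) by (intro finite_UN_I) auto
  ultimately have "(\<Prod>l<N. d l j) \<le> card (\<Union>i\<in>{1..N}. \<Union>u\<in>A i. D u)"
    using card_mono card_level(2)[OF j, of N] by metis
  also have "\<dots> \<le> (\<Sum>i=1..N. card (\<Union>u\<in>A i. D u))"
    by (intro card_UN_le) simp
  also have "\<dots> \<le> (\<Sum>i=1..N. \<Sum>u\<in>A i. card (D u))"
    by (intro sum_mono card_UN_le A)
  also have "\<dots> \<le> (\<Sum>i=1..N. \<Sum>u\<in>A i. \<Prod>l=i..<N. d l j)"
    by (intro sum_mono D)
  also have "\<dots> \<le> (\<Sum>i=1..N. card (newly_protected (i - 1) \<inter> T j) * (\<Prod>l=i..<N. d l j))"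
    by (simp, intro sum_mono mult_right_mono) (use A(2) in auto)
  finally show ?thesis .
qed

lemma sum_newly_protected:
  "(\<Sum>j=1..m. card (newly_protected n \<inter> T j)) \<le> k"
proof -
  have disj: "newly_protected n \<inter> T i \<inter> (newly_protected n \<inter> T j) = {}"
    if "i \<in> {1..m}" "j \<in> {1..m}" "i \<noteq> j" for i j
    using trees_disjoint that unfolding disjoint_family_on_def by blast
  have "(\<Sum>j=1..m. card (newly_protected n \<inter> T j)) = card (\<Union>j\<in>{1..m}. newly_protected n \<inter> T j)"
    using newly_protected_props(2) disj by (intro card_UN_disjoint[symmetric]) auto
  also have "\<dots> \<le> card (newly_protected n)"
    using newly_protected_props(2) by (intro card_mono) auto
  also have "\<dots> \<le> k"
    by (rule newly_protected_props)
  finally show ?thesis .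
qed

lemma contained_imp_balance:
  assumes m: "m \<ge> 1" and pos: "\<And>i j. j \<in> {1..m} \<Longrightarrow> d i j > 0"
    and t: "t \<ge> 1" and contained: "finite (V - saved V E (F t) (P t))"
  shows "\<exists>N p. (\<forall>i\<in>{1..N+1}. (\<Sum>j=1..m. p i j) = k) \<and>
    (\<forall>j\<in>{1..m}. balance (\<lambda>i. d i j) (\<lambda>i. p i j) (N + 1) \<le> 0)"
proof -
  obtain b where b: "\<And>v. v \<in> V - saved V E (F t) (P t) \<Longrightarrow> h v < b"
    using finite_nat_set_iff_bounded[of "h ` (V - saved V E (F t) (P t))"] contained by auto
  \<comment> \<open>From depth \<open>b\<close> on all vertices are saved, \<open>N \<ge> t\<close> makes the turns up to \<open>2 * N + 1\<close>
    include turn \<open>t\<close>, and \<open>N\<close> is a successor because the inequality is about level \<open>t + 1\<close>.\<close>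
  define N where "N = Suc (max t b)"
  have prot: "anc v \<inter> P (Suc (2 * N)) \<noteq> {}" if "j \<in> {1..m}" "v \<in> level j N" for j v
  proof -
    have v: "v \<in> V" "h v = N"
      using that tree_sub unfolding level_def by auto
    then have "v \<in> saved V E (F t) (P t)"
      using b[of v] N_def by (cases "v \<in> saved V E (F t) (P t)") auto
    then have "anc v \<inter> P t \<noteq> {}"
      using saved_iff_anc[OF t v(1)] by simp
    moreover have "P t \<subseteq> P (Suc (2 * N))"
      using t by (intro prot_mono) (auto simp: N_def)
    ultimately show ?thesis by auto
  qed
  define q where "q i j = card (newly_protected (i - 1) \<inter> T j)" for i j
  \<comment> \<open>The entries must add up to exactly \<open>k\<close>; the unused protections go to the first tree, where
    they can only lower the balance.\<close>
  define p where "p i j = q i j + (if j = 1 then k - (\<Sum>j=1..m. q i j) else 0)" for i j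
  have "(\<Sum>j=1..m. p i j) = k" for i
    using sum_newly_protected[of "i - 1"] m unfolding p_def q_def
    by (simp add: sum.distrib sum.delta)
  moreover have "balance (\<lambda>i. d i j) (\<lambda>i. p i j) N \<le> 0" if j: "j \<in> {1..m}" for j
  proof -
    have "(\<Prod>l<N. d l j) \<le> (\<Sum>i=1..N. q i j * (\<Prod>l=i..<N. d l j))"
      using card_level_le[OF j pos[OF j] prot[OF j]] unfolding q_def .
    also have "\<dots> \<le> (\<Sum>i=1..N. p i j * (\<Prod>l=i..<N. d l j))"
      unfolding p_def by (intro sum_mono mult_right_mono) auto
    finally have "int (\<Prod>l<N. d l j) \<le> int (\<Sum>i=1..N. p i j * (\<Prod>l=i..<N. d l j))"
      by (simp only: of_nat_le_iff)
    then show ?thesis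
      unfolding balance_def by simp
  qed
  ultimately show ?thesis
    by (intro exI[of _ "max t b"] exI[of _ p]) (auto simp: N_def)
qed

end

section \<open>A greedy strategy from a non-positive balance\<close>

context leveled_forest
begin

text \<open>Vertices of depth greater than \<open>n\<close> are not yet burning on turn \<open>2 * n + 1\<close>, so they may be
  protected on turn \<open>2 * n + 2\<close> whatever has happened before. The rules then determine the fire.\<close>

lemma process_of_protections:
  fixes S :: "nat \<Rightarrow> 'v set"
  assumes S: "\<And>n. S n \<subseteq> {v \<in> V. n < h v}" "\<And>n. finite (S n)" "\<And>n. card (S n) \<le> k"
  obtains F P where "forest_fire m d V E T r h K k F P" "\<And>n. P (Suc (2 * n)) = (\<Union>i<n. S i)"
proof -
  \<comment> \<open>\<open>B n\<close> is the fire on turns \<open>2 * n + 1\<close> and \<open>2 * n + 2\<close>.\<close>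
  define B where
    "B = rec_nat (r ` {1..m}) (\<lambda>n B. closed_nbhd E B - (\<Union>i<Suc n. S i))"
  have B: "B 0 = r ` {1..m}" "B (Suc n) = closed_nbhd E (B n) - (\<Union>i<Suc n. S i)" for n
    unfolding B_def by simp_all
  define F where "F t = B ((t - 1) div 2)" for t
  define P where "P t = (\<Union>i<t div 2. S i)" for t
  have low: "b \<in> B n \<Longrightarrow> b \<in> V \<and> h b \<le> n" for b n
  proof (induction n arbitrary: b)
    case 0
    then show ?case
      using root_in root_level tree_sub unfolding B by auto
  next
    case (Suc n)
    show ?case
    proof (cases "b \<in> B n")
      case True
      then show ?thesis
        using Suc.IH by force
    next
      case False
      then obtain a where a: "a \<in> B n" "(a, b) \<in> E"
        using Suc.prems unfolding B closed_nbhd_def by auto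
      then have ab: "a \<in> V" "b \<in> V" "b \<in> K a \<or> a \<in> K b"
        using edge_cases[OF a(2)] by auto
      have "h b \<le> Suc (h a)"
        using ab child_props tree_of by (metis le_SucI lessI less_imp_le order_refl)
      then show ?thesis
        using Suc.IH[OF a(1)] ab(2) by simp
    qed
  qed
  have "firefighter_process k V E (r ` {1..m}) F P"
    unfolding firefighter_process_def
  proof (intro conjI allI impI)
    fix t :: nat
    assume "1 \<le> t"
    then obtain n where t: "t = Suc n"
      by (cases t) auto
    have arith: "(2 * t - 1 - 1) div 2 = n" "(2 * t - 1) div 2 = n" "(2 * t) div 2 = Suc n"
      "(2 * t + 1) div 2 = Suc n" "(2 * t + 1 - 1) div 2 = Suc n"
      unfolding t by simp_all
    have "S n \<subseteq> V - F (2 * t - 1)"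
      using S(1)[of n] low[of _ n] unfolding F_def arith by fastforce
    then show "\<exists>S'. S' \<subseteq> V - F (2 * t - 1) \<and> finite S' \<and> card S' \<le> k \<and>
        P (2 * t) = P (2 * t - 1) \<union> S'"
      using S(2,3) unfolding P_def arith lessThan_Suc by (intro exI[of _ "S n"]) auto
    show "F (2 * t) = F (2 * t - 1)"
      unfolding F_def arith ..
    show "F (2 * t + 1) = closed_nbhd E (F (2 * t)) - P (2 * t)"
      unfolding F_def P_def arith B ..
    show "P (2 * t + 1) = P (2 * t)"
      unfolding P_def arith ..
  qed (simp_all add: F_def P_def B)
  then have "forest_fire m d V E T r h K k F P"
    by unfold_locales
  moreover have "P (Suc (2 * n)) = (\<Union>i<n. S i)" for n
    unfolding P_def by simp
  ultimately show ?thesis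
    using that by blast
qed

text \<open>\<open>U n\<close> is the set of exposed vertices at depth \<open>n\<close> under the greedy strategy. The truncated
  subtraction says that all children of \<open>U n\<close> get protected if there are fewer than
  \<open>p (Suc n)\<close>.\<close>

lemma greedy_levels:
  assumes j: "j \<in> {1..m}"
  obtains U where "U 0 = {r j}" "\<And>n. U n \<subseteq> level j n" "\<And>n. finite (U n)"
    "\<And>n. U (Suc n) \<subseteq> (\<Union>v\<in>U n. K v)"
    "\<And>n. card (U (Suc n)) = d n j * card (U n) - p (Suc n)"
proof -
  let ?P = "\<lambda>n A. A \<subseteq> level j n \<and> finite A \<and> (n = 0 \<longrightarrow> A = {r j})"
  let ?Q = "\<lambda>n A B. B \<subseteq> (\<Union>v\<in>A. K v) \<and> card B = d n j * card A - p (Suc n)"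
  have "\<exists>U. \<forall>n. ?P n (U n) \<and> ?Q n (U n) (U (Suc n))"
  proof (rule dependent_nat_choice)
    show "\<exists>A. ?P 0 A"
      using level_0[OF j] by auto
    show "\<exists>B. ?P (Suc n) B \<and> ?Q n A B" if A: "?P n A" for A n
    proof -
      have C: "finite (\<Union>v\<in>A. K v)" "card (\<Union>v\<in>A. K v) = d n j * card A"
        using card_children[OF j] A by auto
      have "(\<Union>v\<in>A. K v) \<subseteq> level j (Suc n)"
        unfolding level_Suc[OF j] using A by auto
      moreover obtain B where "B \<subseteq> (\<Union>v\<in>A. K v)" "card B = d n j * card A - p (Suc n)"
        using obtain_subset_with_card_n[of "d n j * card A - p (Suc n)" "\<Union>v\<in>A. K v"] C
        by (metis diff_le_self)
      ultimately show ?thesis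
        using C(1) by (intro exI[of _ B]) (auto intro: finite_subset)
    qed
  qed
  then show ?thesis
    using that by metis
qed

text \<open>Once the truncated recursion has reached zero it stays there; until then it agrees with the
  balance.\<close>

lemma card_greedy_level:
  assumes "card (U 0) = 1" "\<And>n. card (U (Suc n)) = d n j * card (U n) - p (Suc n)"
  shows "int (card (U n)) = 0 \<or> int (card (U n)) = balance (\<lambda>i. d i j) p n"
proof (induction n)
  case 0
  then show ?case
    using assms(1) by (simp add: balance_0)
next
  case (Suc n)
  then show ?case
    unfolding assms(2) balance_Suc by (auto simp: of_nat_diff_if)
qed

lemma balance_imp_containable:
  assumes total: "\<And>i. i \<in> {1..N} \<Longrightarrow> (\<Sum>j=1..m. p i j) = k"
    and balance: "\<And>j. j \<in> {1..m} \<Longrightarrow> balance (\<lambda>i. d i j) (\<lambda>i. p i j) N \<le> 0"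
  shows "containable k V E (r ` {1..m})"
proof -
  let ?C = "\<lambda>A. \<Union>v\<in>A. K v"
  have "\<exists>U. U 0 = {r j} \<and> (\<forall>n. U n \<subseteq> level j n \<and> finite (U n) \<and> U (Suc n) \<subseteq> ?C (U n) \<and>
    card (U (Suc n)) = d n j * card (U n) - p (Suc n) j)" if "j \<in> {1..m}" for j
    using greedy_levels[OF that, of "\<lambda>i. p i j"] by metis
  then obtain U where U0: "\<And>j. j \<in> {1..m} \<Longrightarrow> U j 0 = {r j}"
    and U: "\<And>j n. j \<in> {1..m} \<Longrightarrow> U j n \<subseteq> level j n \<and> finite (U j n) \<and> U j (Suc n) \<subseteq> ?C (U j n) \<and>
    card (U j (Suc n)) = d n j * card (U j n) - p (Suc n) j"
    by metis
  \<comment> \<open>Protected on turn \<open>2 * n + 2\<close>. From \<open>n = N\<close> on, \<open>p\<close> is unconstrained and could exceed the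
    \<open>k\<close> protections allowed, so nothing is protected.\<close>
  define S where "S n = (if n < N then \<Union>j\<in>{1..m}. ?C (U j n) - U j (Suc n) else {})" for n
  have C: "finite (?C (U j n))" "card (?C (U j n)) = d n j * card (U j n)"
    "?C (U j n) \<subseteq> level j (Suc n)" if j: "j \<in> {1..m}" for j n
    using card_children[OF j, of "U j n" n] U[OF j, of n] level_Suc[OF j, of n] by auto
  have S_level: "S n \<subseteq> {v \<in> V. n < h v}" for n
  proof
    fix v
    assume "v \<in> S n"
    then have "\<exists>j\<in>{1..m}. v \<in> ?C (U j n)"
      unfolding S_def by (cases "n < N") auto
    then obtain j where j: "j \<in> {1..m}" "v \<in> ?C (U j n)" ..
    then have "v \<in> level j (Suc n)"
      using C(3) by (meson subsetD)
    then show "v \<in> {v \<in> V. n < h v}"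
      using tree_sub[OF j(1)] unfolding level_def by simp
  qed
  have S_finite: "finite (S n)" for n
    using C(1) unfolding S_def by auto
  have S_card: "card (S n) \<le> k" for n
  proof (cases "n < N")
    case True
    have "card (?C (U j n) - U j (Suc n)) \<le> p (Suc n) j" if j: "j \<in> {1..m}" for j
      using card_Diff_subset[of "U j (Suc n)" "?C (U j n)"] C(2)[OF j, of n] U[OF j, of n]
        U[OF j, of "Suc n"] by simp
    then have "(\<Sum>j=1..m. card (?C (U j n) - U j (Suc n))) \<le> (\<Sum>j=1..m. p (Suc n) j)"
      by (intro sum_mono) simp
    moreover have "card (\<Union>j\<in>{1..m}. ?C (U j n) - U j (Suc n)) \<le>
      (\<Sum>j=1..m. card (?C (U j n) - U j (Suc n)))"
      by (intro card_UN_le) simp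
    ultimately show ?thesis
      using True total[of "Suc n"] unfolding S_def by simp
  qed (simp add: S_def)
  obtain F P where fire: "forest_fire m d V E T r h K k F P"
    and P: "\<And>n. P (Suc (2 * n)) = (\<Union>i<n. S i)"
    using process_of_protections[OF S_level S_finite S_card] by metis
  interpret forest_fire m d V E T r h K k F P
    by (rule fire)
  have cover: "v \<in> U j n \<or> anc v \<inter> (\<Union>i<n. S i) \<noteq> {}"
    if j: "j \<in> {1..m}" and "n \<le> N" "v \<in> level j n" for j n v
    using that(2,3)
  proof (induction n arbitrary: v)
    case 0
    then show ?case
      using U0[OF j] level_0[OF j] by simp
  next
    case (Suc n)
    then obtain u where u: "u \<in> level j n" "v \<in> K u"
      unfolding level_Suc[OF j] by auto
    then have anc: "anc v = insert v (anc u)"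
      using anc_child tree_sub[OF j] unfolding level_def by auto
    from Suc.IH[OF _ u(1)] Suc.prems(1) consider "u \<in> U j n" | "anc u \<inter> (\<Union>i<n. S i) \<noteq> {}"
      by auto
    then show ?case
    proof cases
      case 1
      then have "v \<in> U j (Suc n) \<or> v \<in> S n"
        using u(2) j Suc.prems(1) unfolding S_def by auto
      then show ?thesis
        unfolding anc lessThan_Suc by auto
    next
      case 2
      then show ?thesis
        unfolding anc lessThan_Suc by auto
    qed
  qed
  have empty: "U j N = {}" if j: "j \<in> {1..m}" for j
  proof -
    have "int (card (U j N)) = 0 \<or> int (card (U j N)) = balance (\<lambda>i. d i j) (\<lambda>i. p i j) N"
      by (rule card_greedy_level) (use U[OF j] U0[OF j] in simp_all)
    then have "int (card (U j N)) \<le> 0"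
      using balance[OF j] by linarith
    then show ?thesis
      using U[OF j, of N] by simp
  qed
  let ?t = "Suc (2 * N)"
  have "v \<in> saved V E (F ?t) (P ?t)" if v: "v \<in> V" "N \<le> h v" for v
  proof -
    obtain j where j: "j \<in> {1..m}" "v \<in> T j"
      by (rule tree_of[OF v(1)])
    obtain u where u: "u \<in> anc v" "h u = N"
      using anc_at_level[OF j v(2)] by auto
    then have "u \<in> level j N"
      using anc_level[OF j] unfolding level_def by simp
    then have "anc u \<inter> P ?t \<noteq> {}"
      using cover[OF j(1) order_refl] empty[OF j(1)] P by simp
    then have "anc v \<inter> P ?t \<noteq> {}"
      using anc_trans[OF u(1)] by auto
    then show ?thesis
      using saved_iff_anc[of ?t v] v(1) by simp
  qed
  then have "V - saved V E (F ?t) (P ?t) \<subseteq> {v \<in> V. h v < N}"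
    by (auto simp: not_le[symmetric])
  then have "finite (V - saved V E (F ?t) (P ?t))"
    using finite_below finite_subset by metis
  then show ?thesis
    unfolding containable_def using process by (intro exI[of _ F] exI[of _ P] conjI exI[of _ ?t]) auto
qed

end

section \<open>Containability of generated forests\<close>

theorem theorem3p3:
  fixes m k :: nat
    and d :: "nat \<Rightarrow> nat \<Rightarrow> nat"
    and V :: "'v set" and E :: "'v rel"
    and T :: "nat \<Rightarrow> 'v set" and r :: "nat \<Rightarrow> 'v"
  assumes "m \<ge> 1" and "k \<ge> 1"
    and "\<And>i j. j \<in> {1..m} \<Longrightarrow> d i j > 0"
    and "generated_forest m d V E T r"
  shows "containable k V E (r ` {1..m}) \<longleftrightarrow>
    (\<exists>(t::nat) (p :: nat \<Rightarrow> nat \<Rightarrow> nat).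
       (\<forall>i\<in>{1..t+1}. (\<Sum>j=1..m. p i j) = k) \<and>
       (\<forall>j\<in>{1..m}.
          (\<Prod>i=0..t. int (d i j))
            - (\<Sum>i=1..t. int (p i j) * (\<Prod>l=i..t. int (d l j)))
            - int (p (t+1) j) \<le> 0))"
    (is "?L \<longleftrightarrow> ?R")
proof -
  obtain h K where forest: "leveled_forest m d V E T r h K"
    using generated_forest_leveled[OF assms(4)] by blast
  show ?thesis
  proof
    assume ?L
    then obtain F P t where process: "firefighter_process k V E (r ` {1..m}) F P"
      and t: "t \<ge> 1" "finite (V - saved V E (F t) (P t))"
      unfolding containable_def by auto
    have "forest_fire m d V E T r h K k F P"
      using forest process by (simp add: forest_fire_def forest_fire_axioms_def)
    from forest_fire.contained_imp_balance[OF this assms(1,3) t]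
    show ?R
      unfolding balance_conv .
  next
    assume ?R
    then obtain t p where "\<And>i. i \<in> {1..t+1} \<Longrightarrow> (\<Sum>j=1..m. p i j) = k"
      "\<And>j. j \<in> {1..m} \<Longrightarrow> balance (\<lambda>i. d i j) (\<lambda>i. p i j) (t + 1) \<le> 0"
      unfolding balance_conv by blast
    then show ?L
      by (rule leveled_forest.balance_imp_containable[OF forest])
  qed
qed

end
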